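(* Let $G$ be a finite normal form game with $n\ge2$ players and payoffs $c_i:S\to\mathbb{R}$. Then $G$ is a coset weighted pure harmonic game if and only if there exists a set of coset-depending weights $w_i(s_{-i})>0$ such that (a) $\displaystyle\sum_{i=1}^n w_i(s_{-i})\,c_i(s)=0$ for every $s\in S$ (where $s=(s_i,s_{-i})$ for each $i$); and (b) for every $i\in N$, every $s_{-i}\in S_{-i}$, every $j\in N$ with $j\neq 1$, and every $s_{-j}\in \prod_{q\ne j,\,q\ne1}S_q$, $$\left(\sum_{x_j\in S_j}w_1(x_j,s_{-j})\right)\left(\sum_{x\in S_i}c_i(x,s_{-i})\right)=0 .$$
   Context: Players $N=\{1,\dots,n\}$, strategy sets $S_i=\{1,\dots,k_i\}$ with $k_i\ge2$, $S=\prod_i S_i$, $S_{-i}=\prod_{j\ne i}S_j$; coset-depending weights are functions $w_i:S_{-i}\to(0,\infty)$, $i\in N$; in particular $w_1$ is a function on $\prod_{q\ne1}S_q$. Put $k=\prod_j k_j$. Let $\delta_m^j$ be the $j$-th column of $I_m$; for a profile $s$ put $x_j=\delta_{k_j}^{s_j}$. The structure vector of $c_i$ is the row vector $V_i^c\in\mathbb{R}^k$ with $c_i(s)=V_i^c(x_1\otimes\cdots\otimes x_n)$, and $V_G=[V_1^c,\dots,V_n^c]\in\mathbb{R}^{nk}$; games are identified with vectors $V_G^T\in\mathbb{R}^{nk}$. Given weights $w_i$, $G$ is a coset weighted potential game with these weights if there is $P:S\to\mathbb{R}$ with $c_i(x,s_{-i})-c_i(y,s_{-i})=w_i(s_{-i})(P(x,s_{-i})-P(y,s_{-i}))$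 for all $i\in N$, $x,y\in S_i$, $s_{-i}\in S_{-i}$; $\mathcal{G}_P^{cw}\subseteq\mathbb{R}^{nk}$ is the subspace of all such $V_G^T$, and $\mathcal{H}^{cw}$ is the orthogonal complement of $\mathcal{G}_P^{cw}$ in $\mathbb{R}^{nk}$ for the standard inner product. $G$ is a coset weighted pure harmonic game if there are weights $w_i(s_{-i})>0$ such that $V_G^T\in\mathcal{H}^{cw}$. *)

theory Defs
  imports "Jordan_Normal_Form.VS_Connect" "HOL-Library.FuncSet"
begin

text \<open>
  Player \<open>i\<close> ranges over \<open>{1..n}\<close> and has the strategy set \<open>{1..k i}\<close>.  A partial profile for a set
  \<open>I\<close> of players is an extensional function on \<open>I\<close>, so \<open>S\<close> is \<open>profiles n k\<close>, \<open>S\<^sub>-\<^sub>i\<close> is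
  \<open>profiles_on ({1..n} - {i}) k\<close>, the profile \<open>(x, s\<^sub>-\<^sub>i)\<close> is \<open>t(i := x)\<close> for \<open>t = s\<^sub>-\<^sub>i\<close>, and
  the \<open>s\<^sub>-\<^sub>i\<close> of \<open>s\<close> is \<open>restrict s ({1..n} - {i})\<close>.  Payoffs and weights are total functions of which
  only the values on these sets are ever used.
\<close>

definition profiles_on :: "nat set \<Rightarrow> (nat \<Rightarrow> nat) \<Rightarrow> (nat \<Rightarrow> nat) set" where
  "profiles_on I k = (\<Pi>\<^sub>E i\<in>I. {1..k i})"

definition profiles :: "nat \<Rightarrow> (nat \<Rightarrow> nat) \<Rightarrow> (nat \<Rightarrow> nat) set" where
  "profiles n k = profiles_on {1..n} k"

definition coset_weights :: "nat \<Rightarrow> (nat \<Rightarrow> nat) \<Rightarrow> (nat \<Rightarrow> (nat \<Rightarrow> nat) \<Rightarrow> real) \<Rightarrow> bool" where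
  "coset_weights n k w \<longleftrightarrow> (\<forall>i\<in>{1..n}. \<forall>t\<in>profiles_on ({1..n} - {i}) k. 0 < w i t)"

definition kron_vec :: "real vec \<Rightarrow> real vec \<Rightarrow> real vec" where
  "kron_vec u v = vec (dim_vec u * dim_vec v) (\<lambda>r. u $ (r div dim_vec v) * v $ (r mod dim_vec v))"

text \<open>
  The product over a list \<open>js\<close> of players of the columns \<open>\<delta>\<close> of the identity matrices; since
  \<^const>\<open>unit_vec\<close> counts from 0, strategy \<open>s j\<close> is unit vector number \<open>s j - 1\<close>.
\<close>

definition kron_units :: "nat list \<Rightarrow> (nat \<Rightarrow> nat) \<Rightarrow> (nat \<Rightarrow> nat) \<Rightarrow> real vec" where
  "kron_units js k s = foldr kron_vec (map (\<lambda>j. unit_vec (k j) (s j - 1)) js) (unit_vec 1 0)"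

definition profile_vec :: "nat \<Rightarrow> (nat \<Rightarrow> nat) \<Rightarrow> (nat \<Rightarrow> nat) \<Rightarrow> real vec" where
  "profile_vec n k s = kron_units [1..<Suc n] k s"

text \<open>Row vectors are represented by \<^typ>\<open>real vec\<close>; existence and uniqueness are shown below.\<close>

definition structure_vec :: "nat \<Rightarrow> (nat \<Rightarrow> nat) \<Rightarrow> ((nat \<Rightarrow> nat) \<Rightarrow> real) \<Rightarrow> real vec" where
  "structure_vec n k f =
     (THE V. V \<in> carrier_vec (\<Prod>j=1..n. k j) \<and> (\<forall>s\<in>profiles n k. f s = V \<bullet> profile_vec n k s))"

definition game_vec :: "nat \<Rightarrow> (nat \<Rightarrow> nat) \<Rightarrow> (nat \<Rightarrow> (nat \<Rightarrow> nat) \<Rightarrow> real) \<Rightarrow> real vec" where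
  "game_vec n k c = foldr (@\<^sub>v) (map (\<lambda>i. structure_vec n k (c i)) [1..<Suc n]) vNil"

definition coset_weighted_potential_game ::
    "nat \<Rightarrow> (nat \<Rightarrow> nat) \<Rightarrow> (nat \<Rightarrow> (nat \<Rightarrow> nat) \<Rightarrow> real) \<Rightarrow> (nat \<Rightarrow> (nat \<Rightarrow> nat) \<Rightarrow> real) \<Rightarrow> bool" where
  "coset_weighted_potential_game n k w c \<longleftrightarrow>
     (\<exists>P :: (nat \<Rightarrow> nat) \<Rightarrow> real.
        \<forall>i\<in>{1..n}. \<forall>x\<in>{1..k i}. \<forall>y\<in>{1..k i}. \<forall>t\<in>profiles_on ({1..n} - {i}) k.
          c i (t(i := x)) - c i (t(i := y)) = w i t * (P (t(i := x)) - P (t(i := y))))"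

definition GP_cw :: "nat \<Rightarrow> (nat \<Rightarrow> nat) \<Rightarrow> (nat \<Rightarrow> (nat \<Rightarrow> nat) \<Rightarrow> real) \<Rightarrow> real vec set" where
  "GP_cw n k w = {game_vec n k c |c. coset_weighted_potential_game n k w c}"

definition H_cw :: "nat \<Rightarrow> (nat \<Rightarrow> nat) \<Rightarrow> (nat \<Rightarrow> (nat \<Rightarrow> nat) \<Rightarrow> real) \<Rightarrow> real vec set" where
  "H_cw n k w = vec_module.orthogonal_complement (n * (\<Prod>j=1..n. k j)) (GP_cw n k w)"

definition coset_weighted_pure_harmonic_game ::
    "nat \<Rightarrow> (nat \<Rightarrow> nat) \<Rightarrow> (nat \<Rightarrow> (nat \<Rightarrow> nat) \<Rightarrow> real) \<Rightarrow> bool" where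
  "coset_weighted_pure_harmonic_game n k c \<longleftrightarrow>
     (\<exists>w. coset_weights n k w \<and> game_vec n k c \<in> H_cw n k w)"


fun profile_index :: "nat list \<Rightarrow> (nat \<Rightarrow> nat) \<Rightarrow> (nat \<Rightarrow> nat) \<Rightarrow> nat" where
  "profile_index [] k s = 0"
| "profile_index (j # js) k s = (s j - 1) * prod_list (map k js) + profile_index js k s"

lemma profile_index_less:
  assumes "\<And>j. j \<in> set js \<Longrightarrow> s j \<in> {1..k j}"
  shows "profile_index js k s < prod_list (map k js)"
  using assms
proof (induction js)
  case (Cons j js)
  let ?K = "prod_list (map k js)"
  have "profile_index js k s < ?K" using Cons by simp
  moreover have "Suc (s j - 1) \<le> k j" using Cons.prems[of j] by auto
  hence "(s j - 1) * ?K + ?K \<le> k j * ?K"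
    using mult_le_mono1[of "Suc (s j - 1)" "k j" ?K] by (simp only: mult_Suc add.commute)
  ultimately show ?case by simp
qed simp

lemma kron_units_eq_unit_vec:
  assumes "\<And>j. j \<in> set js \<Longrightarrow> s j \<in> {1..k j}"
  shows "kron_units js k s = unit_vec (prod_list (map k js)) (profile_index js k s)"
  using assms
proof (induction js)
  case Nil
  show ?case by (simp add: kron_units_def)
next
  case (Cons j js)
  let ?K = "prod_list (map k js)" and ?r = "profile_index js k s"
  have IH: "kron_units js k s = unit_vec ?K ?r" using Cons by simp
  have r: "?r < ?K" using Cons.prems by (intro profile_index_less) simp
  have sj: "s j - 1 < k j" using Cons.prems[of j] by auto
  have rec: "kron_units (j # js) k s = kron_vec (unit_vec (k j) (s j - 1)) (kron_units js k s)"
    by (simp add: kron_units_def)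
  show ?case
  proof (rule eq_vecI)
    fix q assume "q < dim_vec (unit_vec (prod_list (map k (j # js))) (profile_index (j # js) k s))"
    hence q: "q < k j * ?K" by simp
    have K: "0 < ?K" using r by simp
    have "q div ?K < k j" using q by (simp add: less_mult_imp_div_less)
    moreover have "q = (s j - 1) * ?K + ?r \<longleftrightarrow> q div ?K = s j - 1 \<and> q mod ?K = ?r"
      using r by (metis K div_mult_mod_eq div_mult_self3 div_less mod_mult_self3 mod_less
          add.right_neutral less_irrefl)
    ultimately show "kron_units (j # js) k s $ q =
        unit_vec (prod_list (map k (j # js))) (profile_index (j # js) k s) $ q"
      using q K by (simp add: rec IH kron_vec_def unit_vec_def)
  qed (simp add: rec IH kron_vec_def)
qed

lemma profile_index_inj:
  assumes "\<And>j. j \<in> set js \<Longrightarrow> s j \<in> {1..k j}" "\<And>j. j \<in> set js \<Longrightarrow> t j \<in> {1..k j}"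
    and "profile_index js k s = profile_index js k t" "j \<in> set js"
  shows "s j = t j"
  using assms
proof (induction js)
  case (Cons i js)
  let ?K = "prod_list (map k js)"
  have r: "profile_index js k s < ?K" "profile_index js k t < ?K"
    using Cons.prems by (auto intro!: profile_index_less)
  have eq: "(s i - 1) * ?K + profile_index js k s = (t i - 1) * ?K + profile_index js k t"
    using Cons.prems(3) by simp
  have "s i - 1 = t i - 1"
    using arg_cong[OF eq, of "\<lambda>x. x div ?K"] r by (cases "?K = 0") auto
  moreover have "profile_index js k s = profile_index js k t"
    using arg_cong[OF eq, of "\<lambda>x. x mod ?K"] r by simp
  moreover have "s i \<ge> 1" "t i \<ge> 1" using Cons.prems(1,2)[of i] by simp_all
  ultimately have "s i = t i" "profile_index js k s = profile_index js k t" by linarith+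
  thus ?case using Cons by auto
qed simp

lemma prod_list_upt: "prod_list (map k [1..<Suc n]) = (\<Prod>j=1..n. k j)"
  for k :: "nat \<Rightarrow> nat"
  by (simp only: prod.distinct_set_conv_list[OF distinct_upt, symmetric] set_upt
      atLeastLessThanSuc_atLeastAtMost)

lemma profile_vec_eq_unit_vec:
  assumes "s \<in> profiles n k"
  shows "profile_vec n k s = unit_vec (\<Prod>j=1..n. k j) (profile_index [1..<Suc n] k s)"
  unfolding profile_vec_def prod_list_upt[symmetric]
  using assms by (intro kron_units_eq_unit_vec) (auto simp: profiles_def profiles_on_def PiE_iff)

lemma bij_betw_profile_index:
  "bij_betw (profile_index [1..<Suc n] k) (profiles n k) {..<\<Prod>j=1..n. k j}"
proof -
  let ?f = "profile_index [1..<Suc n] k"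
  have range: "s j \<in> {1..k j}" if "s \<in> profiles n k" "j \<in> set [1..<Suc n]" for s j
    using that by (auto simp: profiles_def profiles_on_def PiE_iff)
  have inj: "inj_on ?f (profiles n k)"
  proof (rule inj_onI)
    fix s t assume st: "s \<in> profiles n k" "t \<in> profiles n k" "?f s = ?f t"
    have "s j = t j" if "j \<in> {1..n}" for j
      using st range that by (intro profile_index_inj[of "[1..<Suc n]" s k t j]) auto
    thus "s = t" using st unfolding profiles_def profiles_on_def by (intro PiE_ext) auto
  qed
  have "?f ` profiles n k \<subseteq> {..<\<Prod>j=1..n. k j}"
    using profile_index_less[of "[1..<Suc n]" _ k] range prod_list_upt[of k n] by auto
  moreover have "card (?f ` profiles n k) = (\<Prod>j=1..n. k j)"
    using card_image[OF inj] by (simp add: profiles_def profiles_on_def card_PiE)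
  ultimately have "?f ` profiles n k = {..<\<Prod>j=1..n. k j}"
    by (intro card_subset_eq) auto
  thus ?thesis using inj by (simp add: bij_betw_def)
qed

lemma structure_vec_ex1:
  "\<exists>!V. V \<in> carrier_vec (\<Prod>j=1..n. k j) \<and> (\<forall>s\<in>profiles n k. f s = V \<bullet> profile_vec n k s)"
proof -
  let ?K = "\<Prod>j=1..n. k j" and ?p = "profile_index [1..<Suc n] k"
  note bij = bij_betw_profile_index[of n k]
  have less: "?p s < ?K" if "s \<in> profiles n k" for s
    using bij that by (auto simp: bij_betw_def)
  have nth: "V \<bullet> profile_vec n k s = V $ ?p s" if "s \<in> profiles n k" "V \<in> carrier_vec ?K" for s V
    using that less[of s] by (simp add: profile_vec_eq_unit_vec)
  show ?thesis
  proof (rule ex1I)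
    let ?V = "vec ?K (\<lambda>r. f (inv_into (profiles n k) ?p r))"
    show "?V \<in> carrier_vec ?K \<and> (\<forall>s\<in>profiles n k. f s = ?V \<bullet> profile_vec n k s)"
      using nth[of _ ?V] less bij_betw_inv_into_left[OF bij] by simp
    fix W assume W: "W \<in> carrier_vec ?K \<and> (\<forall>s\<in>profiles n k. f s = W \<bullet> profile_vec n k s)"
    show "W = ?V"
    proof (rule eq_vecI)
      fix r assume "r < dim_vec ?V"
      hence r: "r < ?K" by simp
      then obtain s where s: "s \<in> profiles n k" "r = ?p s"
        using bij by (auto simp: bij_betw_def)
      thus "W $ r = ?V $ r"
        using W nth[of s W] r bij_betw_inv_into_left[OF bij s(1)] by simp
    qed (use W in simp)
  qed
qed

end

theory Submission
  imports Defs
begin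

text \<open>
  A weighted potential game has payoffs \<open>d\<^sub>i(s) = w\<^sub>i(s\<^sub>-\<^sub>i) P(s) + e\<^sub>i(s\<^sub>-\<^sub>i)\<close> with arbitrary \<open>P\<close> and
  \<open>e\<^sub>i\<close>.  Orthogonality to all such games therefore splits: varying \<open>P\<close> gives condition (a), and
  varying \<open>e\<^sub>i\<close> gives \<open>\<Sum>\<^sub>x c\<^sub>i(x, s\<^sub>-\<^sub>i) = 0\<close>, which is condition (b) because the weight sum in (b) is
  positive and a player \<open>j \<noteq> 1\<close> exists.
\<close>

section \<open>Inner products of game vectors as sums over profiles\<close>

lemma structure_vec_spec:
  "structure_vec n k f \<in> carrier_vec (\<Prod>j=1..n. k j) \<and>
   (\<forall>s\<in>profiles n k. f s = structure_vec n k f \<bullet> profile_vec n k s)"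
  unfolding structure_vec_def by (rule theI'[OF structure_vec_ex1])

lemma structure_vec_carrier: "structure_vec n k f \<in> carrier_vec (\<Prod>j=1..n. k j)"
  using structure_vec_spec by (rule conjunct1)

lemma dim_structure_vec [simp]: "dim_vec (structure_vec n k f) = (\<Prod>j=1..n. k j)"
  using structure_vec_carrier by (rule carrier_vecD)

lemma structure_vec_index:
  assumes "s \<in> profiles n k"
  shows "structure_vec n k f $ profile_index [1..<Suc n] k s = f s"
proof -
  have less: "profile_index [1..<Suc n] k s < (\<Prod>j=1..n. k j)"
    using bij_betwE[OF bij_betw_profile_index] assms by blast
  have "f s = structure_vec n k f \<bullet> profile_vec n k s"
    using structure_vec_spec[of n k f] assms by blast
  also have "\<dots> = structure_vec n k f $ profile_index [1..<Suc n] k s"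
    unfolding profile_vec_eq_unit_vec[OF assms]
    by (rule scalar_prod_right_unit[OF less])
  finally show ?thesis by (rule sym)
qed

text \<open>By \<open>bij_betw_profile_index\<close> the profiles enumerate the coordinates exactly
  once, so the coordinatewise sum can be reindexed by profiles.\<close>

lemma scalar_prod_structure_vec:
  "structure_vec n k f \<bullet> structure_vec n k g = (\<Sum>s\<in>profiles n k. f s * g s)"
proof -
  let ?p = "profile_index [1..<Suc n] k"
  have "(\<Sum>s\<in>profiles n k. f s * g s) =
      (\<Sum>s\<in>profiles n k. structure_vec n k f $ ?p s * structure_vec n k g $ ?p s)"
    by (intro sum.cong refl) (simp only: structure_vec_index)
  also have "\<dots> = (\<Sum>r<\<Prod>j=1..n. k j. structure_vec n k f $ r * structure_vec n k g $ r)"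
    by (rule sum.reindex_bij_betw[OF bij_betw_profile_index])
  finally show ?thesis by (simp add: scalar_prod_def atLeast0LessThan)
qed

lemma dim_foldr_append_vec:
  "dim_vec (foldr (@\<^sub>v) vs vNil) = sum_list (map dim_vec vs)"
  by (induction vs) auto

text \<open>Corresponding blocks have equal lengths, hence so do the concatenated tails; the blocks
  line up and the product splits one block at a time.\<close>

lemma scalar_prod_foldr_append_vec:
  assumes "\<And>i. i \<in> set is \<Longrightarrow> dim_vec (u i) = dim_vec (v i)"
  shows "foldr (@\<^sub>v) (map u is) vNil \<bullet> foldr (@\<^sub>v) (map v is) vNil =
    (\<Sum>i\<leftarrow>is. u i \<bullet> (v i :: 'a :: comm_semiring_0 vec))"
  using assms
proof (induction "is")
  case (Cons i "is")
  let ?u = "foldr (@\<^sub>v) (map u is) vNil" and ?v = "foldr (@\<^sub>v) (map v is) vNil"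
  have "map dim_vec (map u is) = map dim_vec (map v is)" using Cons.prems by simp
  hence "?u \<in> carrier_vec (dim_vec ?v)"
    by (simp only: carrier_vec_def mem_Collect_eq dim_foldr_append_vec)
  moreover have "u i \<in> carrier_vec (dim_vec (v i))"
    by (rule carrier_vecI) (rule Cons.prems, simp)
  ultimately have "(u i @\<^sub>v ?u) \<bullet> (v i @\<^sub>v ?v) = u i \<bullet> v i + ?u \<bullet> ?v"
    by (intro scalar_prod_append) auto
  thus ?case using Cons by simp
qed (simp add: scalar_prod_def)

lemma game_vec_carrier: "game_vec n k c \<in> carrier_vec (n * (\<Prod>j=1..n. k j))"
  by (rule carrier_vecI)
    (simp add: game_vec_def dim_foldr_append_vec o_def sum_list_triv del: upt_Suc)

lemma scalar_prod_game_vec: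
  "game_vec n k c \<bullet> game_vec n k d = (\<Sum>i=1..n. \<Sum>s\<in>profiles n k. c i s * d i s)"
proof -
  have "game_vec n k c \<bullet> game_vec n k d =
      (\<Sum>i\<leftarrow>[1..<Suc n]. structure_vec n k (c i) \<bullet> structure_vec n k (d i))"
    unfolding game_vec_def by (rule scalar_prod_foldr_append_vec) simp
  also have "\<dots> = (\<Sum>i=1..n. structure_vec n k (c i) \<bullet> structure_vec n k (d i))"
    by (simp only: sum_list_distinct_conv_sum_set distinct_upt set_upt
        atLeastLessThanSuc_atLeastAtMost)
  finally show ?thesis by (simp only: scalar_prod_structure_vec)
qed

text \<open>Removes the vector encoding: from here on orthogonality is a statement about payoff
  functions only.\<close>

lemma game_vec_in_H_cw_iff:
  "game_vec n k c \<in> H_cw n k w \<longleftrightarrow>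
    (\<forall>d. coset_weighted_potential_game n k w d \<longrightarrow>
      (\<Sum>i=1..n. \<Sum>s\<in>profiles n k. c i s * d i s) = 0)"
  unfolding H_cw_def vec_module.orthogonal_complement_def GP_cw_def
  using game_vec_carrier[of n k c] by (auto simp del: One_nat_def simp: scalar_prod_game_vec)

section \<open>Splitting a profile into one player's strategy and the rest\<close>

lemma finite_profiles_on: "finite I \<Longrightarrow> finite (profiles_on I k)"
  by (simp add: profiles_on_def finite_PiE)

lemma finite_profiles: "finite (profiles n k)"
  by (simp add: profiles_def finite_profiles_on)

lemma restrict_profiles_on: "t \<in> profiles_on I k \<Longrightarrow> restrict t I = t"
  by (simp add: profiles_on_def PiE_restrict)

lemma profile_upd:
  assumes "i \<in> {1..n}" "t \<in> profiles_on ({1..n} - {i}) k" "x \<in> {1..k i}"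
  shows "t(i := x) \<in> profiles n k" "restrict (t(i := x)) ({1..n} - {i}) = t"
proof -
  have "insert i ({1..n} - {i}) = {1..n}" using assms by blast
  thus "t(i := x) \<in> profiles n k"
    using assms PiE_fun_upd[of x "\<lambda>j. {1..k j}" i t "{1..n} - {i}"]
    by (simp add: profiles_def profiles_on_def)
  show "restrict (t(i := x)) ({1..n} - {i}) = t"
    using restrict_profiles_on[OF assms(2)] by simp
qed

lemma restrict_profile:
  "s \<in> profiles n k \<Longrightarrow> restrict s ({1..n} - {i}) \<in> profiles_on ({1..n} - {i}) k"
  by (auto simp: profiles_def profiles_on_def PiE_iff)

lemma restrict_profile_upd:
  assumes "i \<in> {1..n}" "s \<in> profiles n k"
  shows "(restrict s ({1..n} - {i}))(i := s i) = s"
  using assms by (auto simp: profiles_def profiles_on_def PiE_iff extensional_def fun_eq_iff)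

text \<open>The map sending s to the pair of its restriction to the other players and
  \<open>s i\<close> is a bijection, with inverse (t, x) \<mapsto> \<open>t(i := x)\<close>.\<close>

lemma sum_profiles_split:
  assumes i: "i \<in> {1..n}"
  shows "(\<Sum>s\<in>profiles n k. f s) =
    (\<Sum>t\<in>profiles_on ({1..n} - {i}) k. \<Sum>x=1..k i. f (t(i := x)))"
proof -
  have "(\<Sum>t\<in>profiles_on ({1..n} - {i}) k. \<Sum>x=1..k i. f (t(i := x))) =
      (\<Sum>(t, x)\<in>profiles_on ({1..n} - {i}) k \<times> {1..k i}. f (t(i := x)))"
    by (rule sum.cartesian_product)
  also have "\<dots> = (\<Sum>s\<in>profiles n k. f s)"
  proof (rule sum.reindex_bij_witness)
    fix s assume s: "s \<in> profiles n k"
    show "(case (restrict s ({1..n} - {i}), s i) of (t, x) \<Rightarrow> t(i := x)) = s"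
      using restrict_profile_upd[OF i s] by simp
    have "s i \<in> {1..k i}" using s i by (auto simp: profiles_def profiles_on_def PiE_iff)
    thus "(restrict s ({1..n} - {i}), s i) \<in> profiles_on ({1..n} - {i}) k \<times> {1..k i}"
      using restrict_profile[OF s] by simp
  next
    fix p assume "p \<in> profiles_on ({1..n} - {i}) k \<times> {1..k i}"
    thus "(restrict (case p of (t, x) \<Rightarrow> t(i := x)) ({1..n} - {i}),
        (case p of (t, x) \<Rightarrow> t(i := x)) i) = p"
      and "(case p of (t, x) \<Rightarrow> t(i := x)) \<in> profiles n k"
      and "f (case p of (t, x) \<Rightarrow> t(i := x)) = (case p of (t, x) \<Rightarrow> f (t(i := x)))"
      using profile_upd[OF i] by auto
  qed
  finally show ?thesis by simp
qed

section \<open>Orthogonality to all weighted potential games\<close>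

lemma coset_weighted_potential_game_weighted:
  "coset_weighted_potential_game n k w (\<lambda>i s. w i (restrict s ({1..n} - {i})) * P s)"
  unfolding coset_weighted_potential_game_def
  by (intro exI[of _ P]) (auto simp: restrict_profiles_on right_diff_distrib)

lemma coset_weighted_potential_game_nonstrategic:
  "coset_weighted_potential_game n k w (\<lambda>i s. e i (restrict s ({1..n} - {i})))"
  unfolding coset_weighted_potential_game_def
  by (intro exI[of _ "\<lambda>_. 0"]) (auto simp: restrict_profiles_on)

text \<open>On each coset d equals w P plus a constant. The constant is multiplied by the coset sum
  of f, which is zero, so only the part with P survives.\<close>

lemma potential_payoff_sum:
  assumes i: "i \<in> {1..n}" and ki: "k i \<ge> 1"
    and pot: "\<And>x y t. x \<in> {1..k i} \<Longrightarrow> y \<in> {1..k i} \<Longrightarrow> t \<in> profiles_on ({1..n} - {i}) k \<Longrightarrow>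
      d (t(i := x)) - d (t(i := y)) = w t * (P (t(i := x)) - P (t(i := y)))"
    and zero: "\<And>t. t \<in> profiles_on ({1..n} - {i}) k \<Longrightarrow> (\<Sum>x=1..k i. f (t(i := x))) = (0 :: real)"
  shows "(\<Sum>s\<in>profiles n k. f s * d s) =
    (\<Sum>s\<in>profiles n k. w (restrict s ({1..n} - {i})) * f s * P s)"
proof -
  let ?T = "profiles_on ({1..n} - {i}) k"
  \<comment> \<open>Strategy 1 serves as reference point; it is available because \<open>k i\<close>
    is at least 1. Applying \<open>pot\<close> with y = 1 shows that the same \<open>e t\<close>
    works for every x.\<close>
  define e where "e t = d (t(i := 1)) - w t * P (t(i := 1))" for t
  have d: "d (t(i := x)) = w t * P (t(i := x)) + e t" if "t \<in> ?T" "x \<in> {1..k i}" for t x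
    using pot[of x 1 t] that ki by (simp add: e_def algebra_simps)
  have "(\<Sum>s\<in>profiles n k. f s * d s) = (\<Sum>t\<in>?T. \<Sum>x=1..k i. f (t(i := x)) * d (t(i := x)))"
    by (rule sum_profiles_split[OF i])
  also have "\<dots> = (\<Sum>t\<in>?T. \<Sum>x=1..k i. w t * f (t(i := x)) * P (t(i := x)))"
  proof (rule sum.cong[OF refl])
    fix t assume t: "t \<in> ?T"
    have "(\<Sum>x=1..k i. f (t(i := x)) * d (t(i := x))) =
        (\<Sum>x=1..k i. w t * f (t(i := x)) * P (t(i := x)) + f (t(i := x)) * e t)"
      by (rule sum.cong) (simp_all add: d[OF t] algebra_simps)
    also have "\<dots> = (\<Sum>x=1..k i. w t * f (t(i := x)) * P (t(i := x)))
        + (\<Sum>x=1..k i. f (t(i := x))) * e t"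
      by (simp add: sum.distrib sum_distrib_right)
    finally show "(\<Sum>x=1..k i. f (t(i := x)) * d (t(i := x))) =
        (\<Sum>x=1..k i. w t * f (t(i := x)) * P (t(i := x)))"
      using zero[OF t] by simp
  qed
  also have "\<dots> = (\<Sum>t\<in>?T. \<Sum>x=1..k i.
      w (restrict (t(i := x)) ({1..n} - {i})) * f (t(i := x)) * P (t(i := x)))"
    by (intro sum.cong refl) (simp add: restrict_profiles_on)
  also have "\<dots> = (\<Sum>s\<in>profiles n k. w (restrict s ({1..n} - {i})) * f s * P s)"
    by (rule sum_profiles_split[OF i, symmetric])
  finally show ?thesis .
qed

lemma game_vec_in_H_cw_iff_sums:
  assumes k: "\<And>i. i \<in> {1..n} \<Longrightarrow> k i \<ge> 1"
  shows "game_vec n k c \<in> H_cw n k w \<longleftrightarrow>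
    (\<forall>s\<in>profiles n k. (\<Sum>i=1..n. w i (restrict s ({1..n} - {i})) * c i s) = 0) \<and>
    (\<forall>i\<in>{1..n}. \<forall>t\<in>profiles_on ({1..n} - {i}) k. (\<Sum>x=1..k i. c i (t(i := x))) = 0)"
    (is "_ \<longleftrightarrow> ?weighted \<and> ?cosets")
proof
  assume "game_vec n k c \<in> H_cw n k w"
  hence orth: "(\<Sum>i=1..n. \<Sum>s\<in>profiles n k. c i s * d i s) = 0"
    if "coset_weighted_potential_game n k w d" for d
    using that game_vec_in_H_cw_iff by blast
  have ?weighted
  proof
    fix s assume s: "s \<in> profiles n k"
    \<comment> \<open>Test against the game whose potential is the indicator of s: of each player's
      sum only the term at s remains.\<close>
    have "(\<Sum>r\<in>profiles n k. c i r * (w i (restrict r ({1..n} - {i})) * of_bool (r = s))) =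
        w i (restrict s ({1..n} - {i})) * c i s" for i
      using s by (subst sum.remove[OF finite_profiles s]) simp
    thus "(\<Sum>i=1..n. w i (restrict s ({1..n} - {i})) * c i s) = 0"
      using orth[OF coset_weighted_potential_game_weighted[of n k w "\<lambda>r. of_bool (r = s)"]]
      by simp
  qed
  moreover have ?cosets
  proof (intro ballI)
    fix i t assume i: "i \<in> {1..n}" and t: "t \<in> profiles_on ({1..n} - {i}) k"
    \<comment> \<open>This test game pays 1 to player i on the coset of t and 0 in all other cases,
      so its inner product with c is a single coset sum.\<close>
    let ?e = "\<lambda>j r. of_bool (j = i \<and> r = t) :: real"
    have "(\<Sum>j=1..n. \<Sum>s\<in>profiles n k. c j s * ?e j (restrict s ({1..n} - {j}))) =
        (\<Sum>s\<in>profiles n k. c i s * ?e i (restrict s ({1..n} - {i})))"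
      using i by (subst sum.remove[of _ i]) auto
    also have "\<dots> = (\<Sum>u\<in>profiles_on ({1..n} - {i}) k. \<Sum>x=1..k i.
        c i (u(i := x)) * ?e i (restrict (u(i := x)) ({1..n} - {i})))"
      by (rule sum_profiles_split[OF i])
    also have "\<dots> = (\<Sum>u\<in>profiles_on ({1..n} - {i}) k. \<Sum>x=1..k i. c i (u(i := x)) * of_bool (u = t))"
      by (intro sum.cong refl) (simp add: restrict_profiles_on)
    also have "\<dots> = (\<Sum>x=1..k i. c i (t(i := x)))"
      using t by (subst sum.remove[of _ t]) (auto intro: finite_profiles_on)
    finally show "(\<Sum>x=1..k i. c i (t(i := x))) = 0"
      using orth[OF coset_weighted_potential_game_nonstrategic[of n k w ?e]] by simp
  qed
  ultimately show "?weighted \<and> ?cosets" ..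
next
  assume sums: "?weighted \<and> ?cosets"
  show "game_vec n k c \<in> H_cw n k w"
    unfolding game_vec_in_H_cw_iff
  proof (intro allI impI)
    fix d assume "coset_weighted_potential_game n k w d"
    then obtain P where P: "\<And>i x y t. i \<in> {1..n} \<Longrightarrow> x \<in> {1..k i} \<Longrightarrow> y \<in> {1..k i} \<Longrightarrow>
        t \<in> profiles_on ({1..n} - {i}) k \<Longrightarrow>
        d i (t(i := x)) - d i (t(i := y)) = w i t * (P (t(i := x)) - P (t(i := y)))"
      unfolding coset_weighted_potential_game_def by blast
    have "(\<Sum>i=1..n. \<Sum>s\<in>profiles n k. c i s * d i s) =
        (\<Sum>i=1..n. \<Sum>s\<in>profiles n k. w i (restrict s ({1..n} - {i})) * c i s * P s)"
      using P k sums by (intro sum.cong refl potential_payoff_sum) auto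
    \<comment> \<open>All players share the potential P, so after exchanging the sums
      \<open>P s\<close> factors out and its coefficient vanishes by
      \<open>?weighted\<close>.\<close>
    also have "\<dots> =
        (\<Sum>s\<in>profiles n k. (\<Sum>i=1..n. w i (restrict s ({1..n} - {i})) * c i s) * P s)"
      by (subst sum.swap) (simp add: sum_distrib_right)
    also have "\<dots> = 0" using sums by simp
    finally show "(\<Sum>i=1..n. \<Sum>s\<in>profiles n k. c i s * d i s) = 0" .
  qed
qed

section \<open>Reducing condition (b) to vanishing coset sums\<close>

lemma profiles_on_nonempty:
  assumes "\<And>i. i \<in> I \<Longrightarrow> k i \<ge> 1"
  obtains u where "u \<in> profiles_on I k"
proof -
  have "(\<lambda>i\<in>I. 1) \<in> profiles_on I k" using assms by (auto simp: profiles_on_def)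
  thus thesis by (rule that)
qed

text \<open>Adding a strategy of j to u gives a profile of all players but 1, where
  \<open>w 1\<close> is positive; the sum is over a nonempty set.\<close>

lemma coset_weight_sum_pos:
  assumes "coset_weights n k w" "n \<ge> 1" "j \<in> {1..n} - {1}" "k j \<ge> 1"
    and u: "u \<in> profiles_on ({1..n} - {j, 1}) k"
  shows "0 < (\<Sum>x=1..k j. w 1 (u(j := x)))"
proof (rule sum_pos)
  fix x assume x: "x \<in> {1..k j}"
  have "insert j ({1..n} - {j, 1}) = {1..n} - {1}" using assms by auto
  hence "u(j := x) \<in> profiles_on ({1..n} - {1}) k"
    using u x PiE_fun_upd[of x "\<lambda>j. {1..k j}" j u "{1..n} - {j, 1}"]
    by (simp add: profiles_on_def)
  thus "0 < w 1 (u(j := x))" using assms by (auto simp: coset_weights_def)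
qed (use assms in auto)

theorem theorem20:
  fixes n :: nat and k :: "nat \<Rightarrow> nat" and c :: "nat \<Rightarrow> (nat \<Rightarrow> nat) \<Rightarrow> real"
  assumes "n \<ge> 2" and "\<forall>i\<in>{1..n}. k i \<ge> 2"
  shows "coset_weighted_pure_harmonic_game n k c \<longleftrightarrow>
    (\<exists>w. coset_weights n k w \<and>
      (\<forall>s\<in>profiles n k. (\<Sum>i=1..n. w i (restrict s ({1..n} - {i})) * c i s) = 0) \<and>
      (\<forall>i\<in>{1..n}. \<forall>t\<in>profiles_on ({1..n} - {i}) k.
        \<forall>j\<in>{1..n} - {1}. \<forall>u\<in>profiles_on ({1..n} - {j, 1}) k.
          (\<Sum>x=1..k j. w 1 (u(j := x))) * (\<Sum>x=1..k i. c i (t(i := x))) = 0))"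
proof -
  have k: "k i \<ge> 1" if "i \<in> {1..n}" for i using assms(2) that by force
  \<comment> \<open>Player 2 witnesses that j ranges over a nonempty set. For n = 2 the profile u
    below is the empty one.\<close>
  have two: "2 \<in> {1..n} - {1}" using assms(1) by auto
  obtain u where u: "u \<in> profiles_on ({1..n} - {2, 1}) k"
    by (rule profiles_on_nonempty[of "{1..n} - {2, 1}" k]) (use k in auto)
  have product_zero_iff: "(\<forall>j\<in>{1..n} - {1}. \<forall>u\<in>profiles_on ({1..n} - {j, 1}) k.
      (\<Sum>x=1..k j. w 1 (u(j := x))) * a = 0) \<longleftrightarrow> a = 0" if "coset_weights n k w" for w a
  proof
    have "0 < (\<Sum>x=1..k 2. w 1 (u(2 := x)))"
      using assms(1) two k by (intro coset_weight_sum_pos[OF that _ two _ u]) auto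
    moreover assume "\<forall>j\<in>{1..n} - {1}. \<forall>u\<in>profiles_on ({1..n} - {j, 1}) k.
      (\<Sum>x=1..k j. w 1 (u(j := x))) * a = 0"
    hence "(\<Sum>x=1..k 2. w 1 (u(2 := x))) * a = 0" using two u by blast
    ultimately show "a = 0" by simp
  qed simp
  show ?thesis
    unfolding coset_weighted_pure_harmonic_game_def
    \<comment> \<open>The same w serves on both sides. \<open>conj_cong\<close> supplies
      \<open>coset_weights n k w\<close> as the premise of \<open>product_zero_iff\<close>, which is
      used with a the coset sum of \<open>c i\<close>.\<close>
    by (simp only: game_vec_in_H_cw_iff_sums[OF k] product_zero_iff cong: conj_cong)
qed

end
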